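(* Let $\rho^*_{ss}$ be a given performance level, and let $\mathcal G$ be a connected unweighted graph on $n\ge2$ nodes with adjacency matrix $A_{\mathcal G}$ and diameter $\mathrm{diam}(\mathcal G)$ such that $\rho_{ss}(L_{\mathcal G};M_n)=\rho^*_{ss}$. Then the number $\|A_{\mathcal G}\|_0$ of nonzero entries of $A_{\mathcal G}$ satisfies $$\frac{(n-1)^2}{2\rho^*_{ss}}\ \le\ \|A_{\mathcal G}\|_0\ \le\ (n-1)\left[n-4\left(\frac{\rho^*_{ss}-\frac12+\frac1{2n}}{\mathrm{diam}(\mathcal G)}\right)\right].$$
   Context: Graphs are finite, simple, undirected. The diameter is the largest distance between pairs of nodes. $L_{\mathcal G}$ is the graph Laplacian (degree matrix minus adjacency matrix) with eigenvalues $0=\lambda_1<\lambda_2\le\dots\le\lambda_n$, $M_n=I_n-\frac1nJ_n$ is the centering matrix, and $\rho_{ss}(L_{\mathcal G};M_n)=\frac12\sum_{i=2}^n\lambda_i^{-1}$ is the performance measure of the first-order consensus network $\dot x=-L_{\mathcal G}x+\xi$, $y=M_nx$. *)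

theory Defs
  imports
    "Graph_Theory.Graph_Theory"
    "Jordan_Normal_Form.Char_Poly"
    "HOL-Library.Multiset"
    "HOL-Computational_Algebra.Polynomial"
begin

text \<open>
  A finite simple undirected graph is a \<open>pair_graph\<close> (finite, loopless, with a symmetric set of
  arcs), so that every undirected edge is represented by its two orientations. The matrices below
  presuppose that the vertices are \<open>0, \<dots>, n - 1\<close>.
\<close>

definition adjacency_mat :: "nat pair_pre_digraph \<Rightarrow> real mat" where
  "adjacency_mat G =
     mat (card (pverts G)) (card (pverts G)) (\<lambda>(i, j). if (i, j) \<in> parcs G then 1 else 0)"

definition degree_mat :: "nat pair_pre_digraph \<Rightarrow> real mat" where
  "degree_mat G =
     mat (card (pverts G)) (card (pverts G))
       (\<lambda>(i, j). if i = j then real (out_degree (with_proj G) i) else 0)"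

definition laplacian_mat :: "nat pair_pre_digraph \<Rightarrow> real mat" where
  "laplacian_mat G = degree_mat G - adjacency_mat G"

text \<open>
  The real eigenvalues in increasing order, repeated according to algebraic multiplicity; for a
  symmetric matrix of dimension \<open>n\<close> this list has length \<open>n\<close>.
\<close>

definition sorted_eigenvalues :: "real mat \<Rightarrow> real list" where
  "sorted_eigenvalues L = sorted_list_of_multiset (proots (char_poly L))"

text \<open>
  The performance measure of \<open>x' = - L x + \<xi>\<close>, \<open>y = M\<^sub>n x\<close>, where \<open>M\<^sub>n\<close> is the centering
  matrix. List positions start at 0, so the omitted eigenvalue \<open>\<lambda>\<^sub>1\<close> is at position 0.
\<close>

definition rho_ss_centering :: "real mat \<Rightarrow> real" where
  "rho_ss_centering L =
     (1 / 2) * (\<Sum>i = 2..dim_row L. inverse (sorted_eigenvalues L ! (i - 1)))"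

text \<open>With unit weights, \<open>\<mu>\<close> is the least number of arcs of a walk, and \<open>\<infinity>\<close> if there is none.\<close>

definition graph_diameter :: "'a pair_pre_digraph \<Rightarrow> ereal" where
  "graph_diameter G =
     Max ((\<lambda>(u, v). wf_digraph.\<mu> (with_proj G) (\<lambda>_. 1) u v) ` (pverts G \<times> pverts G))"

definition num_nonzero_entries :: "real mat \<Rightarrow> nat" where
  "num_nonzero_entries A = card {(i, j). i < dim_row A \<and> j < dim_col A \<and> A $$ (i, j) \<noteq> 0}"

end

theory Submission
  imports Defs "Jordan_Normal_Form.Schur_Decomposition" "HOL-Analysis.Convex"
begin

text \<open>
  Write \<open>L\<close> for the Laplacian, \<open>m\<close> for the number of arcs (which is both the number of nonzero
  adjacency entries and the trace of \<open>L\<close>), \<open>\<rho>\<close> for the performance level and \<open>D\<close> for the diameter.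

  The lower bound is the Cauchy-Schwarz inequality for the positive eigenvalues: their sum is \<open>m\<close>,
  the sum of their inverses is \<open>2 \<rho>\<close>, and there are \<open>n - 1\<close> of them
  (\<open>square_length_le_sum_times_sum_inverse\<close>).

  For the upper bound, regard the graph as a network of unit resistors. Let \<open>J\<close> be the all-ones
  matrix and \<open>X\<close> the inverse of \<open>L + J / n\<close>. The effective resistance between two nodes is
  \<open>r u v = X u u - X v u - X u v + X v v\<close>, and three facts about it suffice.

  \<^item> Summed over all ordered pairs it gives \<open>2 n (tr X - 1) = 4 n \<rho>\<close>. Adding \<open>J / n\<close> replaces the
    eigenvalue \<open>0\<close> of \<open>L\<close> by \<open>1\<close> and keeps the others, so that \<open>tr X = 1 + 2 \<rho>\<close>
    (\<open>mat_trace_shifted_inverse\<close>).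

  \<^item> Summed over the arcs it gives \<open>2 (n - 1)\<close>; this is Foster's theorem (\<open>resistance_sum_arcs\<close>).

  \<^item> It is at most the distance, hence at most \<open>D\<close>: the potential drop of a unit current is \<open>r u v\<close>
    and so is its energy, while Cauchy-Schwarz along a path of length \<open>d\<close> bounds the square of the
    drop by \<open>d\<close> times the energy (\<open>resistance_le_length\<close>).

  Exactly \<open>n (n - 1) - m\<close> ordered pairs of distinct nodes are nonadjacent, and therefore
  \<open>4 n \<rho> \<le> 2 (n - 1) + D (n (n - 1) - m)\<close>. With \<open>s = \<rho> - 1 / 2 + 1 / (2 n)\<close> this reads
  \<open>m \<le> n (n - 1) - 4 n s / D\<close>, slightly stronger than the claim, which has \<open>n - 1\<close> in place of the
  coefficient \<open>n\<close> of \<open>4 s / D\<close>.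
\<close>

section \<open>Real spectra and traces\<close>

lemma mult_mat_vec_entry:
  assumes "A \<in> carrier_mat n m" "v \<in> carrier_vec m" "i < n"
  shows "(A *\<^sub>v v) $ i = (\<Sum>l<m. A $$ (i, l) * v $ l)"
  using assms by (auto simp: scalar_prod_def atLeast0LessThan intro!: sum.cong)

lemma mult_mat_entry:
  assumes "A \<in> carrier_mat n m" "B \<in> carrier_mat m k" "i < n" "j < k"
  shows "(A * B) $$ (i, j) = (\<Sum>l<m. A $$ (i, l) * B $$ (l, j))"
  using assms by (auto simp: scalar_prod_def atLeast0LessThan intro!: sum.cong)

text \<open>
  For an eigenvector \<open>v\<close> the number \<open>v\<^sup>* A v\<close> equals both \<open>z |v|\<^sup>2\<close> and its own conjugate.
\<close>

lemma symmetric_eigenvalue_real: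
  fixes A :: "real mat"
  assumes A: "A \<in> carrier_mat n n"
    and sym: "\<And>i j. i < n \<Longrightarrow> j < n \<Longrightarrow> A $$ (i, j) = A $$ (j, i)"
    and ev: "eigenvalue (map_mat complex_of_real A) z"
  shows "z \<in> \<real>"
proof -
  from ev A obtain v where v: "v \<in> carrier_vec n" "v \<noteq> 0\<^sub>v n"
    and eq: "map_mat complex_of_real A *\<^sub>v v = z \<cdot>\<^sub>v v"
    by (auto simp: eigenvalue_def eigenvector_def)
  have row: "(\<Sum>j<n. of_real (A $$ (i, j)) * v $ j) = z * v $ i" if "i < n" for i
  proof -
    have "(map_mat complex_of_real A *\<^sub>v v) $ i = (\<Sum>j<n. of_real (A $$ (i, j)) * v $ j)"
      using that A v(1) by (subst mult_mat_vec_entry[of _ n n]) auto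
    then show ?thesis using eq that v(1) by simp
  qed
  define N where "N = (\<Sum>i<n. (cmod (v $ i))\<^sup>2)"
  define S where "S = (\<Sum>i<n. \<Sum>j<n. cnj (v $ i) * (of_real (A $$ (i, j)) * v $ j))"
  have S_eq: "S = z * of_real N"
  proof -
    have "S = (\<Sum>i<n. cnj (v $ i) * (z * v $ i))"
      unfolding S_def by (intro sum.cong refl) (simp add: row flip: sum_distrib_left)
    also have "\<dots> = z * of_real N"
      unfolding N_def of_real_sum sum_distrib_left
      by (intro sum.cong refl) (simp add: complex_norm_square mult_ac del: of_real_power)
    finally show ?thesis .
  qed
  have "cnj S = (\<Sum>i<n. \<Sum>j<n. cnj (v $ j) * (of_real (A $$ (j, i)) * v $ i))"
    unfolding S_def cnj_sum by (intro sum.cong refl) (simp add: sym mult_ac)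
  also have "\<dots> = S"
    unfolding S_def by (rule sum.swap)
  finally have "cnj S = S" .
  moreover have "N \<noteq> 0"
  proof
    assume "N = 0"
    then have "\<forall>i\<in>{..<n}. (cmod (v $ i))\<^sup>2 = 0"
      unfolding N_def by (subst (asm) sum_nonneg_eq_0_iff) auto
    then have "v = 0\<^sub>v n" using v(1) by (intro eq_vecI) auto
    with v(2) show False by simp
  qed
  ultimately have "cnj z = z" unfolding S_eq by simp
  then show ?thesis by (simp add: Reals_cnj_iff)
qed

lemma sorted_list_of_proots_linear_factors:
  fixes es :: "real list"
  shows "sorted_list_of_multiset (proots (\<Prod>e\<leftarrow>es. [:- e, 1:])) = sort es"
proof -
  have "proots (\<Prod>e\<leftarrow>es. [:- e, 1:]) = mset es"
  proof (induction es)
    case (Cons e es)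
    have "[:- e, 1:] * (\<Prod>e\<leftarrow>es. [:- e, 1:]) \<noteq> 0"
      unfolding mult_eq_0_iff by auto
    then show ?case using Cons by (simp add: proots_mult del: mult_pCons_left)
  qed simp
  then show ?thesis by simp
qed

text \<open>
  Over the complex numbers the characteristic polynomial splits, and all its roots are real. This
  makes the sorted list of real eigenvalues complete, so that indexing it up to \<open>n - 1\<close> is meaningful
  and a Schur decomposition can be taken over the reals, with the eigenvalues in sorted order.
\<close>

lemma symmetric_char_poly_splits:
  fixes A :: "real mat"
  assumes A: "A \<in> carrier_mat n n"
    and sym: "\<And>i j. i < n \<Longrightarrow> j < n \<Longrightarrow> A $$ (i, j) = A $$ (j, i)"
  shows "char_poly A = (\<Prod>e\<leftarrow>sorted_eigenvalues A. [:- e, 1:])"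
    and "length (sorted_eigenvalues A) = n"
proof -
  let ?C = "map_mat complex_of_real A"
  have C: "?C \<in> carrier_mat n n" using A by simp
  from char_poly_factorized[OF C] obtain zs where
    zs: "char_poly ?C = (\<Prod>z\<leftarrow>zs. [:- z, 1:])" "length zs = n" by blast
  have real: "z \<in> \<real>" if "z \<in> set zs" for z
  proof (rule symmetric_eigenvalue_real[OF A sym])
    have "poly (char_poly ?C) z = 0"
      using that unfolding zs(1) by (simp add: linear_poly_root)
    then show "eigenvalue ?C z" by (simp add: eigenvalue_root_char_poly[OF C])
  qed
  define es where "es = map Re zs"
  have zs_es: "zs = map of_real es"
    unfolding es_def using real by (auto intro!: nth_equalityI simp: of_real_Re)
  interpret cr: inj_idom_hom complex_of_real ..
  interpret crp: map_poly_inj_idom_hom complex_of_real ..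
  have "map_poly complex_of_real (char_poly A) = map_poly complex_of_real (\<Prod>e\<leftarrow>es. [:- e, 1:])"
    by (simp add: of_real_hom.char_poly_hom[OF A, symmetric] zs(1) zs_es crp.hom_prod_list o_def)
  then have cp: "char_poly A = (\<Prod>e\<leftarrow>es. [:- e, 1:])" by simp
  have srt: "sorted_eigenvalues A = sort es"
    unfolding sorted_eigenvalues_def cp by (rule sorted_list_of_proots_linear_factors)
  have "(\<Prod>e\<leftarrow>es. [:- e, 1:]) = (\<Prod>e\<leftarrow>sort es. [:- e, 1:])"
    by (simp flip: prod_mset_prod_list)
  with cp srt show "char_poly A = (\<Prod>e\<leftarrow>sorted_eigenvalues A. [:- e, 1:])" by simp
  show "length (sorted_eigenvalues A) = n"
    using srt zs(2) by (simp add: es_def)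
qed

definition mat_trace :: "'a::comm_ring_1 mat \<Rightarrow> 'a" where
  "mat_trace A = (\<Sum>i<dim_row A. A $$ (i, i))"

lemma mat_trace_mult_comm:
  assumes "A \<in> carrier_mat n m" "B \<in> carrier_mat m n"
  shows "mat_trace (A * B) = mat_trace (B * A)"
proof -
  have "mat_trace (A * B) = (\<Sum>i<n. \<Sum>k<m. A $$ (i, k) * B $$ (k, i))"
    using assms by (simp add: mat_trace_def mult_mat_entry[OF assms] del: index_mult_mat(1))
  also have "\<dots> = (\<Sum>k<m. \<Sum>i<n. B $$ (k, i) * A $$ (i, k))"
    by (subst sum.swap) (simp add: mult.commute)
  also have "\<dots> = mat_trace (B * A)"
    using assms by (simp add: mat_trace_def mult_mat_entry[OF assms(2,1)] del: index_mult_mat(1))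
  finally show ?thesis .
qed

lemma mat_trace_conjugate:
  assumes "P \<in> carrier_mat n n" "Q \<in> carrier_mat n n" "B \<in> carrier_mat n n" "Q * P = 1\<^sub>m n"
  shows "mat_trace (P * B * Q) = mat_trace B"
proof -
  have "mat_trace (P * B * Q) = mat_trace (Q * (P * B))"
    using assms by (intro mat_trace_mult_comm) auto
  also have "Q * (P * B) = B"
    using assms by (simp flip: assoc_mult_mat[of Q n n P n B n])
  finally show ?thesis .
qed

text \<open>
  Back substitution: going through the rows from the bottom up, the entries of \<open>Y\<close> below the diagonal
  vanish, and then only one term is left in each diagonal entry of \<open>C * Y\<close>.
\<close>

lemma upper_triangular_right_inverse_diag:
  fixes C :: "'a::field mat"
  assumes C: "C \<in> carrier_mat n n" and ut: "upper_triangular C"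
    and Y: "Y \<in> carrier_mat n n" and inv: "C * Y = 1\<^sub>m n" and i: "i < n"
  shows "C $$ (i, i) \<noteq> 0" "Y $$ (i, i) = inverse (C $$ (i, i))"
proof -
  have entry: "(\<Sum>k<n. C $$ (i, k) * Y $$ (k, j)) = (if i = j then 1 else 0)"
    if "i < n" "j < n" for i j
    using mult_mat_entry[OF C Y that] inv that by simp
  have "det C * det Y = 1"
    using det_mult[OF C Y] inv by simp
  then have "prod_list (diag_mat C) \<noteq> 0"
    using det_upper_triangular[OF ut C] by force
  then have diag: "C $$ (i, i) \<noteq> 0" if "i < n" for i
    using that C by (auto simp: prod_list_zero_iff diag_mat_def)
  have lower: "Y $$ (i, j) = 0" if "j < i" "i < n" for i j
    using that
  proof (induction "n - i" arbitrary: i rule: less_induct)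
    case less
    have "(\<Sum>k<n. C $$ (i, k) * Y $$ (k, j)) = (\<Sum>k\<in>{i}. C $$ (i, k) * Y $$ (k, j))"
    proof (intro sum.mono_neutral_right ballI)
      fix k assume "k \<in> {..<n} - {i}"
      then consider "k < i" | "i < k" "k < n" by fastforce
      then show "C $$ (i, k) * Y $$ (k, j) = 0"
      proof cases
        case 1
        then show ?thesis using ut C less.prems by auto
      next
        case 2
        then show ?thesis using less by simp
      qed
    qed (use less.prems in auto)
    then have "C $$ (i, i) * Y $$ (i, j) = 0"
      using entry[of i j] less.prems by simp
    then show ?case using diag[of i] less.prems by simp
  qed
  have "(\<Sum>k<n. C $$ (i, k) * Y $$ (k, i)) = (\<Sum>k\<in>{i}. C $$ (i, k) * Y $$ (k, i))"
  proof (intro sum.mono_neutral_right ballI)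
    fix k assume "k \<in> {..<n} - {i}"
    then consider "k < i" | "i < k" "k < n" by fastforce
    then show "C $$ (i, k) * Y $$ (k, i) = 0"
    proof cases
      case 1
      then show ?thesis using ut C i by auto
    next
      case 2
      then show ?thesis using lower by simp
    qed
  qed (use i in auto)
  then have "C $$ (i, i) * Y $$ (i, i) = 1"
    using entry[of i i] i by simp
  then show "C $$ (i, i) \<noteq> 0" "Y $$ (i, i) = inverse (C $$ (i, i))"
    using diag[OF i] by (auto simp: field_simps)
qed

lemma mat_trace_eq_sum_eigenvalues:
  fixes A :: "'a::conjugatable_ordered_field mat"
  assumes A: "A \<in> carrier_mat n n" and cp: "char_poly A = (\<Prod>e\<leftarrow>es. [:- e, 1:])"
  shows "mat_trace A = sum_list es"
proof -
  obtain B P Q where schur: "schur_decomposition A es = (B, P, Q)"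
    by (metis prod_cases3)
  note sd = schur_decomposition[OF A cp schur]
  note w = similar_mat_witD2[OF A conjunct1[OF sd]]
  have "mat_trace A = mat_trace B"
    using mat_trace_conjugate[of P n Q B] w by simp
  also have "\<dots> = sum_list (diag_mat B)"
    using w by (simp add: mat_trace_def diag_mat_def sum_list_distinct_conv_sum_set atLeast0LessThan)
  finally show ?thesis using sd by simp
qed

text \<open>
  Take a Schur decomposition \<open>A = P B Q\<close> whose diagonal starts with the eigenvalue \<open>0\<close>. The first
  column of \<open>B\<close> is then zero, hence the first column of \<open>P\<close> lies in the kernel of \<open>A\<close> and is constant.
  As \<open>Q P = 1\<close>, all rows of \<open>Q\<close> but the first have sum \<open>0\<close>, so that only the first row of \<open>Q J P\<close> is
  nonzero, where \<open>J\<close> is the constant matrix that is added to \<open>A\<close>. Conjugation by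
  \<open>P\<close> thus turns the shifted matrix into an upper triangular one with the diagonal \<open>1 # es\<close>, and the
  trace of its inverse can be read off.
\<close>

lemma mat_trace_shifted_inverse:
  fixes A X :: "real mat"
  assumes A: "A \<in> carrier_mat n n" and n: "0 < n"
    and cp: "char_poly A = (\<Prod>e\<leftarrow>0 # es. [:- e, 1:])"
    and ker: "\<And>v. v \<in> carrier_vec n \<Longrightarrow> A *\<^sub>v v = 0\<^sub>v n \<Longrightarrow> \<exists>c. v = vec n (\<lambda>_. c)"
    and X: "X \<in> carrier_mat n n"
    and inv: "(A + mat n n (\<lambda>_. 1 / real n)) * X = 1\<^sub>m n"
  shows "0 \<notin> set es" "mat_trace X = 1 + (\<Sum>e\<leftarrow>es. inverse e)"
proof -
  define J where "J = mat n n (\<lambda>_. 1 / real n)"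
  have J: "J \<in> carrier_mat n n" by (simp add: J_def)
  obtain B P Q where schur: "schur_decomposition A (0 # es) = (B, P, Q)"
    by (metis prod_cases3)
  note sd = schur_decomposition[OF A cp schur]
  from sd have ut: "upper_triangular B" and dB: "diag_mat B = 0 # es" by auto
  note w = similar_mat_witD2[OF A conjunct1[OF sd]]
  note PQ = w(1) and QP = w(2) and APBQ = w(3) and B = w(5) and P = w(6) and Q = w(7)
  have len: "length es = n - 1"
    using arg_cong[OF dB, of length] B by (simp add: diag_mat_def)
  have B_diag: "B $$ (i, i) = (0 # es) ! i" if "i < n" for i
    using B that by (simp add: diag_mat_def flip: dB)
  have AP: "A * P = P * B"
    unfolding APBQ using P Q B QP by (simp add: assoc_mult_mat[of _ n n _ n _ n])
  have "col B 0 = 0\<^sub>v n"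
  proof (rule eq_vecI)
    fix i assume "i < dim_vec (0\<^sub>v n :: real vec)"
    then show "col B 0 $ i = 0\<^sub>v n $ i"
      using B n B_diag[of 0] upper_triangularD[OF ut, of 0 i] by (cases i) auto
  qed (use B in auto)
  moreover have "P *\<^sub>v 0\<^sub>v n = 0\<^sub>v n"
    using P by (intro eq_vecI) auto
  ultimately have "A *\<^sub>v col P 0 = 0\<^sub>v n"
    using col_mult2[OF A P n] col_mult2[OF P B n] AP by simp
  moreover have "col P 0 \<in> carrier_vec n" using P by (intro carrier_vecI) simp
  ultimately obtain c where c: "col P 0 = vec n (\<lambda>_. c)" using ker by blast
  have P0: "P $$ (i, 0) = c" if "i < n" for i
    using arg_cong[OF c, of "\<lambda>v. v $ i"] that P n by simp
  define q where "q i = (\<Sum>k<n. Q $$ (i, k))" for i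
  have cq: "c * q i = (if i = 0 then 1 else 0)" if "i < n" for i
  proof -
    have "(Q * P) $$ (i, 0) = (\<Sum>k<n. Q $$ (i, k) * P $$ (k, 0))"
      by (rule mult_mat_entry[OF Q P that n])
    also have "\<dots> = c * q i"
      by (simp add: q_def sum_distrib_left P0 mult.commute)
    finally show ?thesis using QP that n by simp
  qed
  have c0: "c \<noteq> 0" using cq[OF n] by auto
  have q0: "q i = 0" if "i < n" "i \<noteq> 0" for i
    using cq[OF that(1)] that(2) c0 by simp
  have QJP: "(Q * J * P) $$ (i, j) = q i * (\<Sum>l<n. P $$ (l, j)) / real n"
    if "i < n" "j < n" for i j
  proof -
    have QJ: "(Q * J) $$ (i, l) = q i / real n" if "l < n" for l
      unfolding mult_mat_entry[OF Q J \<open>i < n\<close> that] q_def sum_divide_distrib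
      using that by (intro sum.cong) (auto simp: J_def)
    have "(Q * J * P) $$ (i, j) = (\<Sum>l<n. (Q * J) $$ (i, l) * P $$ (l, j))"
      by (rule mult_mat_entry[OF mult_carrier_mat[OF Q J] P that])
    also have "\<dots> = q i * (\<Sum>l<n. P $$ (l, j)) / real n"
      by (simp add: QJ sum_distrib_left sum_divide_distrib del: index_mult_mat(1))
    finally show ?thesis .
  qed
  define C where "C = Q * (A + J) * P"
  have C: "C \<in> carrier_mat n n" unfolding C_def using Q A J P by (intro mult_carrier_mat add_carrier_mat)
  have "C = Q * (A * P) + Q * J * P"
    unfolding C_def using A J P Q
    by (simp add: mult_add_distrib_mat[of Q n n] add_mult_distrib_mat[of _ n n]
        assoc_mult_mat[of _ n n _ n _ n])
  also have "Q * (A * P) = B"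
    unfolding AP using Q P B QP by (simp flip: assoc_mult_mat[of Q n n P n B n])
  finally have C_eq: "C = B + Q * J * P" .
  have C_entry: "C $$ (i, j) = B $$ (i, j) + q i * (\<Sum>l<n. P $$ (l, j)) / real n"
    if "i < n" "j < n" for i j
    unfolding C_eq using that B Q P J QJP[OF that] by (simp del: index_mult_mat(1))
  have utC: "upper_triangular C"
    using C B ut by (intro upper_triangularI) (auto simp: C_entry q0)
  have C0: "C $$ (0, 0) = 1"
    using C_entry[OF n n] B_diag[OF n] cq[OF n] n by (simp add: P0 mult.commute)
  have Ci: "C $$ (Suc i, Suc i) = es ! i" if "Suc i < n" for i
    using C_entry[OF that that] B_diag[OF that] q0[OF that] by simp
  define Y where "Y = Q * X * P"
  have Y: "Y \<in> carrier_mat n n" using Q X P by (simp add: Y_def)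
  have AJ: "A + J \<in> carrier_mat n n" and XP: "X * P \<in> carrier_mat n n"
    using A J X P by auto
  have "C * Y = Q * (A + J) * P * (Q * (X * P))"
    unfolding C_def Y_def assoc_mult_mat[OF Q X P] ..
  also have "\<dots> = Q * (A + J) * (P * (Q * (X * P)))"
    by (rule assoc_mult_mat[OF mult_carrier_mat[OF Q AJ] P mult_carrier_mat[OF Q XP]])
  also have "P * (Q * (X * P)) = X * P"
    using XP by (simp only: assoc_mult_mat[OF P Q XP, symmetric] PQ left_mult_one_mat)
  also have "Q * (A + J) * (X * P) = Q * ((A + J) * X * P)"
    by (simp only: assoc_mult_mat[OF Q AJ XP] assoc_mult_mat[OF AJ X P])
  also have "\<dots> = 1\<^sub>m n"
    using inv QP P by (simp add: J_def)
  finally have CY: "C * Y = 1\<^sub>m n" .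
  note Yd = upper_triangular_right_inverse_diag[OF C utC Y CY]
  show "0 \<notin> set es"
  proof
    assume "0 \<in> set es"
    then obtain i where "es ! i = 0" "Suc i < n"
      using len by (auto simp: in_set_conv_nth)
    with Yd(1) Ci show False by metis
  qed
  have "mat_trace X = mat_trace Y"
    unfolding Y_def using mat_trace_conjugate[OF Q P X PQ] by simp
  also have "\<dots> = (\<Sum>i<n. inverse (C $$ (i, i)))"
    using Y Yd(2) by (simp add: mat_trace_def)
  also have "\<dots> = inverse (C $$ (0, 0)) + (\<Sum>i<n - 1. inverse (C $$ (Suc i, Suc i)))"
    using n by (cases n) (simp_all add: sum.lessThan_Suc_shift del: sum.lessThan_Suc)
  also have "\<dots> = 1 + (\<Sum>i<n - 1. inverse (es ! i))"
    using Ci C0 by simp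
  also have "(\<Sum>i<n - 1. inverse (es ! i)) = (\<Sum>e\<leftarrow>es. inverse e)"
    using len by (simp add: sum_list_sum_nth atLeast0LessThan)
  finally show "mat_trace X = 1 + (\<Sum>e\<leftarrow>es. inverse e)" .
qed

lemma square_length_le_sum_times_sum_inverse:
  fixes xs :: "real list"
  assumes pos: "\<And>x. x \<in> set xs \<Longrightarrow> 0 < x"
  shows "(real (length xs))\<^sup>2 \<le> sum_list xs * (\<Sum>x\<leftarrow>xs. inverse x)"
proof -
  let ?I = "{..<length xs}"
  have p: "0 < xs ! i" if "i \<in> ?I" for i
    using pos that by simp
  have "(real (length xs))\<^sup>2 = (\<Sum>i\<in>?I. sqrt (xs ! i) * sqrt (inverse (xs ! i)))\<^sup>2"
    using p by (simp add: less_imp_neq[THEN not_sym] flip: real_sqrt_mult)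
  also have "\<dots> \<le> (\<Sum>i\<in>?I. (sqrt (xs ! i))\<^sup>2) * (\<Sum>i\<in>?I. (sqrt (inverse (xs ! i)))\<^sup>2)"
    by (rule Cauchy_Schwarz_ineq_sum)
  also have "\<dots> = (\<Sum>i\<in>?I. xs ! i) * (\<Sum>i\<in>?I. inverse (xs ! i))"
    using p by (simp add: less_imp_le)
  also have "\<dots> = sum_list xs * (\<Sum>x\<leftarrow>xs. inverse x)"
    by (simp add: sum_list_sum_nth atLeast0LessThan)
  finally show ?thesis .
qed

section \<open>The graph as an electrical network\<close>

context pair_graph
begin

definition laplacian :: "('a \<Rightarrow> real) \<Rightarrow> 'a \<Rightarrow> real" where
  "laplacian f i = (\<Sum>j\<in>pverts G. of_bool ((i, j) \<in> parcs G) * (f i - f j))"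

lemma sum_arcs_eq:
  fixes h :: "'a \<Rightarrow> 'a \<Rightarrow> real"
  shows "(\<Sum>(i, j)\<in>parcs G. h i j) = (\<Sum>i\<in>pverts G. \<Sum>j\<in>pverts G. of_bool ((i, j) \<in> parcs G) * h i j)"
proof -
  have sub: "parcs G \<subseteq> pverts G \<times> pverts G"
    by (auto intro: in_arcsD1 in_arcsD2)
  have "(\<Sum>i\<in>pverts G. \<Sum>j\<in>pverts G. of_bool ((i, j) \<in> parcs G) * h i j)
      = (\<Sum>(i, j)\<in>pverts G \<times> pverts G. of_bool ((i, j) \<in> parcs G) * h i j)"
    by (rule sum.cartesian_product)
  also have "\<dots> = (\<Sum>(i, j)\<in>parcs G. of_bool ((i, j) \<in> parcs G) * h i j)"
    using sub by (intro sum.mono_neutral_right) auto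
  also have "\<dots> = (\<Sum>(i, j)\<in>parcs G. h i j)"
    by (intro sum.cong) auto
  finally show ?thesis ..
qed

text \<open>
  Every edge is present with both orientations.
\<close>

lemma sum_arcs_swap:
  fixes h :: "'a \<Rightarrow> 'a \<Rightarrow> real"
  shows "(\<Sum>(i, j)\<in>parcs G. h j i) = (\<Sum>(i, j)\<in>parcs G. h i j)"
  by (rule sum.reindex_bij_witness[where i = prod.swap and j = prod.swap])
     (auto intro: arcs_symmetric)

lemma sum_mult_laplacian_eq_arcs:
  "(\<Sum>i\<in>pverts G. g i * laplacian f i) = (\<Sum>(i, j)\<in>parcs G. g i * (f i - f j))"
  unfolding sum_arcs_eq laplacian_def sum_distrib_left
  by (intro sum.cong refl) (rule mult.left_commute)

lemma dirichlet_form: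
  "(\<Sum>i\<in>pverts G. f i * laplacian f i) = (\<Sum>(i, j)\<in>parcs G. (f i - f j)\<^sup>2) / 2"
proof -
  have "2 * (\<Sum>(i, j)\<in>parcs G. f i * (f i - f j))
      = (\<Sum>(i, j)\<in>parcs G. f i * (f i - f j)) + (\<Sum>(i, j)\<in>parcs G. f j * (f j - f i))"
    using sum_arcs_swap[of "\<lambda>i j. f i * (f i - f j)"] by simp
  also have "\<dots> = (\<Sum>(i, j)\<in>parcs G. (f i - f j)\<^sup>2)"
    by (simp add: sum.distrib[symmetric] case_prod_unfold power2_eq_square algebra_simps)
  finally show ?thesis by (simp add: sum_mult_laplacian_eq_arcs)
qed

lemma sum_laplacian_zero: "(\<Sum>i\<in>pverts G. laplacian f i) = 0"
proof -
  have "(\<Sum>(i, j)\<in>parcs G. f i - f j) = (\<Sum>(i, j)\<in>parcs G. f i) - (\<Sum>(i, j)\<in>parcs G. f j)"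
    by (simp add: sum_subtractf case_prod_unfold)
  then show ?thesis
    using sum_mult_laplacian_eq_arcs[of "\<lambda>_. 1" f] sum_arcs_swap[of "\<lambda>i j. f i"] by simp
qed

lemma awalk_telescope:
  fixes f :: "'a \<Rightarrow> real"
  shows "awalk u p v \<Longrightarrow> f u - f v = (\<Sum>e\<leftarrow>p. f (fst e) - f (snd e))"
proof (induction p arbitrary: u)
  case (Cons e p)
  then have "u = fst e" "awalk (snd e) p v" by (auto simp: awalk_simps)
  with Cons.IH[of "snd e"] show ?case by simp
qed (auto simp: awalk_simps)

lemma apath_Cons_avoids_start:
  assumes p: "apath u (d # p) v" and c: "c \<in> set p"
  shows "fst c \<noteq> u" "snd c \<noteq> u"
proof -
  from p have d: "apath (snd d) p v" "u \<notin> set (awalk_verts (snd d) p)"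
    by (auto simp: apath_simps)
  have "fst c \<in> set (awalk_verts (snd d) p)" "snd c \<in> set (awalk_verts (snd d) p)"
    using awalkI_apath[OF d(1)] c by (auto simp: set_awalk_verts simp del: awalk_verts_with_proj_eq)
  then show "fst c \<noteq> u" "snd c \<noteq> u" using d(2) by auto
qed

text \<open>
  A path visits its start only once, so it cannot use an edge in both directions. Since the Dirichlet
  form counts every edge in both orientations and halves the sum, this is what makes the constant in
  \<open>potential_drop_le\<close> equal to the length of the path rather than to twice that length.
\<close>

lemma apath_no_reversal:
  "apath u p v \<Longrightarrow> e \<in> set p \<Longrightarrow> prod.swap e \<notin> set p"
proof (induction p arbitrary: u)
  case (Cons d p)
  from Cons.prems(1) have d: "fst d = u" "d \<in> parcs G" "apath (snd d) p v"
    by (auto simp: apath_simps)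
  have "fst d \<noteq> snd d" using d(2) no_loops by auto
  with d(1) Cons.prems(2) Cons.IH[OF d(3)] apath_Cons_avoids_start[OF Cons.prems(1)] show ?case
    by (cases d; cases e) fastforce
qed simp

lemma apath_distinct_arcs: "apath u p v \<Longrightarrow> distinct p"
proof (induction p arbitrary: u)
  case (Cons d p)
  from Cons.prems have d: "fst d = u" "apath (snd d) p v"
    by (auto simp: apath_simps)
  with Cons.IH[OF d(2)] apath_Cons_avoids_start(1)[OF Cons.prems, of d] show ?case by auto
qed simp

text \<open>
  Cauchy-Schwarz for the drops along the path, whose squares are among the terms of the energy.
\<close>

lemma potential_drop_le:
  fixes f :: "'a \<Rightarrow> real"
  assumes p: "apath u p v"
  shows "(f u - f v)\<^sup>2 \<le> real (length p) * ((\<Sum>(i, j)\<in>parcs G. (f i - f j)\<^sup>2) / 2)"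
proof -
  define D where "D e = (f (fst e) - f (snd e))\<^sup>2" for e
  have arcs: "set p \<subseteq> parcs G"
    using awalkI_apath[OF p] by (auto simp: awalk_def)
  have dist: "distinct p" using p by (rule apath_distinct_arcs)
  have swap: "sum D (prod.swap ` set p) = sum D (set p)"
    by (subst sum.reindex) (auto simp: D_def power2_commute)
  have "2 * sum D (set p) = sum D (set p \<union> prod.swap ` set p)"
    using apath_no_reversal[OF p] by (subst sum.union_disjoint) (auto simp: swap)
  also have "\<dots> \<le> sum D (parcs G)"
    using arcs by (intro sum_mono2) (auto simp: D_def intro: arcs_symmetric)
  finally have half: "sum D (set p) \<le> sum D (parcs G) / 2" by simp
  have "(f u - f v)\<^sup>2 = (\<Sum>e\<in>set p. f (fst e) - f (snd e))\<^sup>2"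
    using awalk_telescope[OF awalkI_apath[OF p], of f] dist
    by (simp add: sum_list_distinct_conv_sum_set)
  also have "\<dots> \<le> (\<Sum>e\<in>set p. (f (fst e) - f (snd e))\<^sup>2) * real (card (set p))"
    by (rule sum_squared_le_sum_of_squares)
  also have "\<dots> = real (length p) * sum D (set p)"
    by (simp add: D_def distinct_card[OF dist])
  also have "\<dots> \<le> real (length p) * (sum D (parcs G) / 2)"
    using half by (intro mult_left_mono) auto
  finally show ?thesis by (simp add: D_def case_prod_unfold)
qed

text \<open>
  Column \<open>j\<close> of a Green kernel is the potential of a unit current that enters at \<open>j\<close> and leaves
  uniformly spread over all nodes. On a connected network it is unique up to an additive constant.
\<close>

definition green_kernel :: "('a \<Rightarrow> 'a \<Rightarrow> real) \<Rightarrow> bool" where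
  "green_kernel x \<longleftrightarrow> (\<forall>i\<in>pverts G. \<forall>j\<in>pverts G.
     laplacian (\<lambda>k. x k j) i = of_bool (i = j) - 1 / real (card (pverts G)))"

text \<open>
  For a Green kernel \<open>x\<close> this is the drop from \<open>u\<close> to \<open>v\<close> of the potential of a unit current from
  \<open>u\<close> to \<open>v\<close>, the effective resistance. The bracketing separates two summands that are exchanged by swapping \<open>u\<close> and \<open>v\<close>.
\<close>

definition resistance :: "('a \<Rightarrow> 'a \<Rightarrow> real) \<Rightarrow> 'a \<Rightarrow> 'a \<Rightarrow> real" where
  "resistance x u v = (x u u - x v u) + (x v v - x u v)"

text \<open>
  The difference \<open>h\<close> of columns \<open>u\<close> and \<open>v\<close> of the kernel is the potential of a unit current from \<open>u\<close>
  to \<open>v\<close>. Its energy equals its drop from \<open>u\<close> to \<open>v\<close>, so \<open>potential_drop_le\<close> bounds the square of the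
  resistance by the length times the resistance.
\<close>

lemma resistance_le_length:
  assumes x: "green_kernel x" and p: "apath u p v"
  shows "resistance x u v \<le> real (length p)"
proof -
  from awalkI_apath[OF p] have uv: "u \<in> pverts G" "v \<in> pverts G"
    using awalk_hd_in_verts awalk_last_in_verts by auto
  define h where "h k = x k u - x k v" for k
  let ?r = "resistance x u v" and ?E = "(\<Sum>(i, j)\<in>parcs G. (h i - h j)\<^sup>2) / 2"
  have laplacian_h: "laplacian h i = of_bool (i = u) - of_bool (i = v)" if "i \<in> pverts G" for i
  proof -
    have "laplacian h i = laplacian (\<lambda>k. x k u) i - laplacian (\<lambda>k. x k v) i"
      by (simp add: laplacian_def h_def sum_subtractf[symmetric] algebra_simps)
    then show ?thesis using x uv that by (simp add: green_kernel_def)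
  qed
  have "?E = (\<Sum>i\<in>pverts G. h i * (of_bool (i = u) - of_bool (i = v)))"
    unfolding dirichlet_form[symmetric] by (intro sum.cong refl) (simp add: laplacian_h)
  also have "\<dots> = (\<Sum>i\<in>pverts G. if i = u then h i else 0) - (\<Sum>i\<in>pverts G. if i = v then h i else 0)"
    unfolding sum_subtractf[symmetric] by (intro sum.cong refl) simp
  also have "\<dots> = h u - h v"
    using uv by simp
  finally have E: "?E = ?r" and hr: "h u - h v = ?r"
    by (simp_all add: h_def resistance_def)
  have "?r\<^sup>2 \<le> real (length p) * ?r"
    using potential_drop_le[OF p, of h] unfolding E hr .
  moreover have "0 \<le> ?r"
    unfolding E[symmetric] by (auto intro!: divide_nonneg_pos sum_nonneg)
  ultimately show ?thesis
    by (cases "?r = 0") (auto simp: power2_eq_square)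
qed

text \<open>
  Foster's theorem: summing \<open>x u u - x v u\<close> over the neighbours \<open>v\<close> of \<open>u\<close> gives the Laplacian of
  column \<open>u\<close> at \<open>u\<close>, which is \<open>1 - 1 / n\<close>.
\<close>

lemma resistance_sum_arcs:
  assumes x: "green_kernel x" and ne: "pverts G \<noteq> {}"
  shows "(\<Sum>(u, v)\<in>parcs G. resistance x u v) = 2 * (real (card (pverts G)) - 1)"
proof -
  have "(\<Sum>(u, v)\<in>parcs G. x u u - x v u) = (\<Sum>u\<in>pverts G. laplacian (\<lambda>k. x k u) u)"
    by (simp add: sum_arcs_eq laplacian_def)
  also have "\<dots> = (\<Sum>u\<in>pverts G. 1 - 1 / real (card (pverts G)))"
    using x by (simp add: green_kernel_def)
  also have "\<dots> = real (card (pverts G)) - 1"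
    using ne by (simp add: right_diff_distrib)
  finally have "(\<Sum>(u, v)\<in>parcs G. x u u - x v u) = real (card (pverts G)) - 1" .
  then show ?thesis
    using sum_arcs_swap[of "\<lambda>u v. x u u - x v u"]
    by (simp add: resistance_def case_prod_unfold sum.distrib)
qed

lemma resistance_sum_pairs:
  assumes "\<And>j. j \<in> pverts G \<Longrightarrow> (\<Sum>k\<in>pverts G. x k j) = 1"
  shows "(\<Sum>u\<in>pverts G. \<Sum>v\<in>pverts G. resistance x u v)
    = 2 * real (card (pverts G)) * ((\<Sum>u\<in>pverts G. x u u) - 1)"
proof -
  have "(\<Sum>u\<in>pverts G. \<Sum>v\<in>pverts G. x v u) = real (card (pverts G))"
    using assms by simp
  moreover have "(\<Sum>u\<in>pverts G. \<Sum>v\<in>pverts G. x u v) = real (card (pverts G))"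
    by (subst sum.swap) (use assms in simp)
  ultimately show ?thesis
    by (simp add: resistance_def sum.distrib sum_subtractf algebra_simps sum_distrib_left)
qed

lemma strongly_connected_if_connected: "connected (with_proj G) \<Longrightarrow> strongly_connected (with_proj G)"
  by (intro symmetric_connected_imp_strongly_connected) (auto simp: sym_arcs)

lemma awalk_cost_unit: "awalk_cost (\<lambda>_. 1) p = real (length p)"
  by (induction p) auto

lemma shortest_apath:
  assumes conn: "connected (with_proj G)" and uv: "u \<in> pverts G" "v \<in> pverts G"
  obtains p where "apath u p v" "ereal (real (length p)) = \<mu> (\<lambda>_. 1) u v"
proof -
  have "u \<rightarrow>\<^sup>*\<^bsub>with_proj G\<^esub> v"
    using strongly_connected_if_connected[OF conn] uv by (auto simp: strongly_connected_def)
  from min_cost_awalk[OF this, of "\<lambda>_. 1"] obtain p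
    where "apath u p v" "\<mu> (\<lambda>_. 1) u v = awalk_cost (\<lambda>_. 1) p" by auto
  with that show thesis by (simp add: awalk_cost_unit)
qed

lemma apath_length_le_diameter:
  assumes conn: "connected (with_proj G)" and uv: "u \<in> pverts G" "v \<in> pverts G"
  obtains p where "apath u p v" "real (length p) \<le> real_of_ereal (graph_diameter G)"
proof -
  let ?S = "(\<lambda>(u, v). \<mu> (\<lambda>_. 1) u v) ` (pverts G \<times> pverts G)"
  have fin: "finite ?S" by auto
  have diam: "graph_diameter G = Max ?S" by (simp add: graph_diameter_def)
  have "Max ?S \<in> ?S" using uv by (intro Max_in fin) auto
  then obtain a b where ab: "a \<in> pverts G" "b \<in> pverts G" "graph_diameter G = \<mu> (\<lambda>_. 1) a b"
    unfolding diam by auto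
  obtain q :: "('a \<times> 'a) awalk" where "ereal (real (length q)) = \<mu> (\<lambda>_. 1) a b"
    by (rule shortest_apath[OF conn ab(1,2)])
  with ab(3) have q: "graph_diameter G = ereal (real (length q))" by simp
  from shortest_apath[OF conn uv] obtain p where
    p: "apath u p v" "ereal (real (length p)) = \<mu> (\<lambda>_. 1) u v" .
  have "\<mu> (\<lambda>_. 1) u v \<le> graph_diameter G"
    unfolding diam using uv by (intro Max_ge fin) auto
  then have "real (length p) \<le> real_of_ereal (graph_diameter G)"
    unfolding q p(2)[symmetric] by simp
  with p(1) show thesis by (rule that)
qed

text \<open>
  A harmonic function has energy \<open>0\<close>, so it cannot drop along a path.
\<close>

lemma harmonic_imp_const:
  assumes conn: "connected (with_proj G)" and f: "\<And>i. i \<in> pverts G \<Longrightarrow> laplacian f i = 0"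
    and uv: "u \<in> pverts G" "v \<in> pverts G"
  shows "f u = f v"
proof -
  from shortest_apath[OF conn uv] obtain p where p: "apath u p v" by blast
  have "(\<Sum>(i, j)\<in>parcs G. (f i - f j)\<^sup>2) / 2 = 0"
    unfolding dirichlet_form[symmetric] using f by simp
  with potential_drop_le[OF p, of f] show ?thesis by simp
qed

lemma card_nonadjacent_pairs:
  "real (card (pverts G \<times> pverts G - parcs G - Id_on (pverts G)))
    = real (card (pverts G)) * (real (card (pverts G)) - 1) - real (card (parcs G))"
proof -
  let ?V = "pverts G"
  have sub: "parcs G \<subseteq> ?V \<times> ?V" by (auto intro: in_arcsD1 in_arcsD2)
  have Id: "Id_on ?V = (\<lambda>v. (v, v)) ` ?V" by (auto simp: Id_on_def)
  have "card (parcs G \<union> Id_on ?V) = card (parcs G) + card ?V"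
    by (subst card_Un_disjoint) (auto simp: Id card_image inj_on_def dest: no_loops)
  moreover have "parcs G \<union> Id_on ?V \<subseteq> ?V \<times> ?V"
    using sub by (auto simp: Id)
  then have "card (?V \<times> ?V - (parcs G \<union> Id_on ?V)) + card (parcs G \<union> Id_on ?V) = card (?V \<times> ?V)"
    using card_Diff_subset[of "parcs G \<union> Id_on ?V" "?V \<times> ?V"]
      card_mono[of "?V \<times> ?V" "parcs G \<union> Id_on ?V"]
    by (simp add: Id)
  ultimately have "card (?V \<times> ?V - parcs G - Id_on ?V) + card (parcs G) + card ?V = card ?V * card ?V"
    by (simp add: Diff_eq Int_assoc card_cartesian_product)
  from arg_cong[OF this, of real] show ?thesis by (simp add: algebra_simps)
qed

lemma sum_pairs_split:
  fixes h :: "'a \<Rightarrow> 'a \<Rightarrow> real"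
  assumes diag: "\<And>v. v \<in> pverts G \<Longrightarrow> h v v = 0"
  shows "(\<Sum>u\<in>pverts G. \<Sum>v\<in>pverts G. h u v) = (\<Sum>(u, v)\<in>parcs G. h u v)
    + (\<Sum>(u, v)\<in>pverts G \<times> pverts G - parcs G - Id_on (pverts G). h u v)"
proof -
  let ?V = "pverts G"
  have sub: "parcs G \<subseteq> ?V \<times> ?V" by (auto intro: in_arcsD1 in_arcsD2)
  have "(\<Sum>u\<in>?V. \<Sum>v\<in>?V. h u v) = (\<Sum>(u, v)\<in>?V \<times> ?V. h u v)"
    by (rule sum.cartesian_product)
  also have "\<dots> = (\<Sum>(u, v)\<in>?V \<times> ?V - parcs G. h u v) + (\<Sum>(u, v)\<in>parcs G. h u v)"
    using sub by (intro sum.subset_diff) auto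
  also have "(\<Sum>(u, v)\<in>?V \<times> ?V - parcs G. h u v)
      = (\<Sum>(u, v)\<in>?V \<times> ?V - parcs G - Id_on ?V. h u v)"
    using diag by (intro sum.mono_neutral_right) auto
  finally show ?thesis by simp
qed

text \<open>
  Foster's theorem accounts for the adjacent pairs exactly; every other pair of distinct nodes has
  resistance at most the diameter.
\<close>

lemma sum_resistance_le:
  assumes conn: "connected (with_proj G)" and ne: "pverts G \<noteq> {}"
    and x: "green_kernel x"
  shows "(\<Sum>u\<in>pverts G. \<Sum>v\<in>pverts G. resistance x u v)
    \<le> 2 * (real (card (pverts G)) - 1) + real_of_ereal (graph_diameter G)
      * (real (card (pverts G)) * (real (card (pverts G)) - 1) - real (card (parcs G)))"
proof -
  let ?V = "pverts G" and ?D = "real_of_ereal (graph_diameter G)"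
  let ?R = "?V \<times> ?V - parcs G - Id_on ?V"
  have "(\<Sum>(u, v)\<in>?R. resistance x u v) \<le> (\<Sum>(u, v)\<in>?R. ?D)"
  proof (rule sum_mono, clarify)
    fix u v assume "u \<in> ?V" "v \<in> ?V"
    with apath_length_le_diameter[OF conn] obtain p where
      p: "apath u p v" "real (length p) \<le> ?D" by blast
    from resistance_le_length[OF x p(1)] p(2) show "resistance x u v \<le> ?D" by simp
  qed
  also have "\<dots> = ?D * (real (card ?V) * (real (card ?V) - 1) - real (card (parcs G)))"
    by (simp add: case_prod_unfold card_nonadjacent_pairs)
  finally show ?thesis
    using sum_pairs_split[of "resistance x"] resistance_sum_arcs[OF x ne]
    by (simp add: resistance_def)
qed

end

section \<open>The spectrum of the Laplacian matrix\<close>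

locale numbered_graph = pair_graph G for G :: "nat pair_pre_digraph" +
  fixes n :: nat
  assumes verts: "pverts G = {0..<n}"
begin

lemma card_verts [simp]: "card (pverts G) = n"
  by (simp add: verts)

lemma verts_lessThan: "pverts G = {..<n}"
  by (simp add: verts atLeast0LessThan)

lemma laplacian_carrier [simp]: "laplacian_mat G \<in> carrier_mat n n"
  unfolding laplacian_mat_def degree_mat_def adjacency_mat_def card_verts
  by (intro minus_carrier_mat) simp

lemma out_degree_eq_sum:
  "real (out_degree (with_proj G) i) = (\<Sum>j\<in>pverts G. of_bool ((i, j) \<in> parcs G))"
proof -
  have "out_arcs (with_proj G) i = Pair i ` {j \<in> pverts G. (i, j) \<in> parcs G}"
    by (auto simp: out_arcs_def intro: in_arcsD2)
  then have "out_degree (with_proj G) i = card {j \<in> pverts G. (i, j) \<in> parcs G}"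
    by (simp add: out_degree_def card_image inj_on_def)
  then show ?thesis by (simp add: Int_def)
qed

lemma laplacian_entry:
  assumes "i < n" "j < n"
  shows "laplacian_mat G $$ (i, j)
    = (if i = j then \<Sum>k\<in>pverts G. of_bool ((i, k) \<in> parcs G) else 0) - of_bool ((i, j) \<in> parcs G)"
  using assms by (simp add: laplacian_mat_def degree_mat_def adjacency_mat_def out_degree_eq_sum)

lemma laplacian_symmetric:
  "i < n \<Longrightarrow> j < n \<Longrightarrow> laplacian_mat G $$ (i, j) = laplacian_mat G $$ (j, i)"
  using arcs_symmetric by (auto simp: laplacian_entry)

lemma sum_laplacian_entries:
  assumes "i < n"
  shows "(\<Sum>j<n. laplacian_mat G $$ (i, j) * f j) = laplacian f i"
proof -
  let ?a = "\<lambda>j. of_bool ((i, j) \<in> parcs G) :: real"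
  have "(\<Sum>j<n. laplacian_mat G $$ (i, j) * f j)
      = (\<Sum>j<n. if i = j then (\<Sum>k\<in>pverts G. ?a k) * f i else 0) - (\<Sum>j<n. ?a j * f j)"
    unfolding sum_subtractf[symmetric] using assms
    by (intro sum.cong refl) (simp add: laplacian_entry left_diff_distrib del: sum_of_bool_eq)
  also have "(\<Sum>j<n. if i = j then (\<Sum>k\<in>pverts G. ?a k) * f i else 0) = (\<Sum>j<n. ?a j * f i)"
    using assms by (simp add: sum_distrib_right verts_lessThan del: sum_of_bool_eq sum_of_bool_mult_eq sum_mult_of_bool_eq)
  also have "(\<Sum>j<n. ?a j * f i) - (\<Sum>j<n. ?a j * f j) = laplacian f i"
    unfolding laplacian_def verts_lessThan by (simp only: right_diff_distrib sum_subtractf)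
  finally show ?thesis .
qed

lemma laplacian_mult_vec:
  assumes "v \<in> carrier_vec n" "i < n"
  shows "(laplacian_mat G *\<^sub>v v) $ i = laplacian (\<lambda>j. v $ j) i"
  unfolding mult_mat_vec_entry[OF laplacian_carrier assms] by (rule sum_laplacian_entries[OF assms(2)])

lemma card_arcs_eq_sum:
  "real (card (parcs G)) = (\<Sum>i\<in>pverts G. \<Sum>j\<in>pverts G. of_bool ((i, j) \<in> parcs G))"
  using sum_arcs_eq[of "\<lambda>_ _. 1"] by (simp add: case_prod_unfold)

lemma laplacian_trace: "mat_trace (laplacian_mat G) = real (card (parcs G))"
proof -
  have "mat_trace (laplacian_mat G) = (\<Sum>i<n. \<Sum>j\<in>pverts G. of_bool ((i, j) \<in> parcs G))"
    unfolding mat_trace_def using carrier_matD[OF laplacian_carrier]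
    by (intro sum.cong) (auto simp: laplacian_entry dest: no_loops)
  then show ?thesis by (simp only: card_arcs_eq_sum verts_lessThan)
qed

lemma adjacency_nonzero_entries: "num_nonzero_entries (adjacency_mat G) = card (parcs G)"
proof -
  have "{(i, j). i < dim_row (adjacency_mat G) \<and> j < dim_col (adjacency_mat G)
      \<and> adjacency_mat G $$ (i, j) \<noteq> 0} = parcs G"
    using in_arcsD1 in_arcsD2 by (auto simp: adjacency_mat_def verts split: if_splits)
  then show ?thesis by (simp add: num_nonzero_entries_def)
qed

text \<open>
  The Dirichlet form of an eigenvector is the eigenvalue times a positive sum of squares.
\<close>

lemma laplacian_eigenvalue_nonneg:
  assumes "eigenvalue (laplacian_mat G) e"
  shows "0 \<le> e"
proof -
  from assms obtain v where v: "v \<in> carrier_vec n" "v \<noteq> 0\<^sub>v n"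
    and eq: "laplacian_mat G *\<^sub>v v = e \<cdot>\<^sub>v v"
    using carrier_matD[OF laplacian_carrier] by (auto simp: eigenvalue_def eigenvector_def)
  have "laplacian (\<lambda>j. v $ j) i = e * v $ i" if "i < n" for i
    using laplacian_mult_vec[OF v(1) that] that v(1) unfolding eq by simp
  then have "(\<Sum>i\<in>pverts G. v $ i * laplacian (\<lambda>j. v $ j) i) = e * (\<Sum>i\<in>pverts G. (v $ i)\<^sup>2)"
    unfolding sum_distrib_left by (intro sum.cong) (auto simp: verts power2_eq_square)
  then have "0 \<le> e * (\<Sum>i\<in>pverts G. (v $ i)\<^sup>2)"
    unfolding dirichlet_form by (metis (mono_tags, lifting) case_prod_beta divide_nonneg_pos sum_nonneg zero_le_power2 zero_less_numeral)
  moreover obtain i where "i < n" "v $ i \<noteq> 0"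
    using v by (metis carrier_vecD dim_vec eq_vecI index_zero_vec)
  then have "0 < (\<Sum>i\<in>pverts G. (v $ i)\<^sup>2)"
    by (intro sum_pos2[of _ i]) (auto simp: verts)
  ultimately show ?thesis by (simp add: zero_le_mult_iff)
qed

text \<open>
  The constant vector shows that \<open>0\<close> is an eigenvalue. No eigenvalue is negative, so \<open>0\<close> comes first
  in the sorted list.
\<close>

lemma laplacian_spectrum:
  assumes "0 < n"
  obtains es where "sorted_eigenvalues (laplacian_mat G) = 0 # es"
    "char_poly (laplacian_mat G) = (\<Prod>e\<leftarrow>0 # es. [:- e, 1:])"
    "length es = n - 1" "\<And>e. e \<in> set es \<Longrightarrow> 0 \<le> e"
proof -
  let ?L = "laplacian_mat G"
  let ?es = "sorted_eigenvalues ?L"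
  have cp: "char_poly ?L = (\<Prod>e\<leftarrow>?es. [:- e, 1:])" "length ?es = n"
    by (rule symmetric_char_poly_splits[OF laplacian_carrier]; rule laplacian_symmetric; assumption)+
  have ev: "eigenvalue ?L e \<longleftrightarrow> e \<in> set ?es" for e
    unfolding eigenvalue_root_char_poly[OF laplacian_carrier] cp(1)
    by (auto simp: poly_prod_list prod_list_zero_iff)
  have nonneg: "0 \<le> e" if "e \<in> set ?es" for e
    using laplacian_eigenvalue_nonneg that ev by blast
  have "?L *\<^sub>v vec n (\<lambda>_. 1) = 0 \<cdot>\<^sub>v vec n (\<lambda>_. 1)"
  proof (rule eq_vecI)
    fix i assume "i < dim_vec (0 \<cdot>\<^sub>v vec n (\<lambda>_. 1 :: real))"
    then have i: "i < n" by simp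
    have "laplacian (\<lambda>j. vec n (\<lambda>_. 1) $ j) i = 0"
      unfolding laplacian_def using i by (intro sum.neutral) (auto simp: verts)
    then show "(?L *\<^sub>v vec n (\<lambda>_. 1)) $ i = (0 \<cdot>\<^sub>v vec n (\<lambda>_. 1)) $ i"
      using laplacian_mult_vec[OF vec_carrier i] i by simp
  qed (use carrier_matD[OF laplacian_carrier] in simp)
  moreover have "vec n (\<lambda>_. 1 :: real) \<noteq> 0\<^sub>v n"
    using assms by (metis index_vec index_zero_vec(1) zero_neq_one)
  ultimately have "eigenvalue ?L 0"
    using carrier_matD[OF laplacian_carrier] unfolding eigenvalue_def eigenvector_def
    by (intro exI[of _ "vec n (\<lambda>_. 1)"]) auto
  then have zero: "0 \<in> set ?es" by (simp add: ev)
  then obtain e es where es: "?es = e # es" by (cases ?es) auto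
  have "sorted ?es" by (simp add: sorted_eigenvalues_def)
  then have "e = 0" using zero nonneg es by force
  show thesis
    by (rule that[of es]) (use es \<open>e = 0\<close> cp nonneg in auto)
qed

lemma laplacian_kernel:
  assumes conn: "connected (with_proj G)" and v: "v \<in> carrier_vec n"
    and zero: "laplacian_mat G *\<^sub>v v = 0\<^sub>v n"
  shows "\<exists>c. v = vec n (\<lambda>_. c)"
proof -
  have "laplacian (\<lambda>j. v $ j) i = 0" if "i \<in> pverts G" for i
    using laplacian_mult_vec[OF v, of i] that zero by (simp add: verts)
  then have const: "v $ i = v $ 0" if "i < n" for i
    using that by (intro harmonic_imp_const[OF conn]) (auto simp: verts)
  have "v = vec n (\<lambda>_. v $ 0)"
  proof (rule eq_vecI)
    fix i assume "i < dim_vec (vec n (\<lambda>_. v $ 0))"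
    then have i: "i < n" by simp
    show "v $ i = vec n (\<lambda>_. v $ 0) $ i"
      unfolding index_vec[OF i] by (rule const[OF i])
  qed (use v in simp)
  then show ?thesis by blast
qed

text \<open>
  The columns of \<open>L\<close> sum to zero and those of \<open>J / n\<close> to one. A vector in the kernel of \<open>L + J / n\<close>
  therefore has entry sum zero, so it lies in the kernel of \<open>L\<close>, is constant, and vanishes. For the same
  reason every column of the inverse has sum one, so that these columns form a Green kernel.
\<close>

lemma shifted_laplacian_inverse:
  assumes conn: "connected (with_proj G)" and n: "0 < n"
  obtains X where "X \<in> carrier_mat n n"
    "(laplacian_mat G + mat n n (\<lambda>_. 1 / real n)) * X = 1\<^sub>m n"
    "green_kernel (\<lambda>i j. X $$ (i, j))"
    "\<And>j. j \<in> pverts G \<Longrightarrow> (\<Sum>k\<in>pverts G. X $$ (k, j)) = 1"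
proof -
  let ?M = "laplacian_mat G + mat n n (\<lambda>_. 1 / real n)"
  have M: "?M \<in> carrier_mat n n" by simp
  have row: "(\<Sum>k<n. ?M $$ (i, k) * f k) = laplacian f i + (\<Sum>k<n. f k) / real n"
    if "i < n" for i and f :: "nat \<Rightarrow> real"
  proof -
    have "(\<Sum>k<n. ?M $$ (i, k) * f k) = (\<Sum>k<n. laplacian_mat G $$ (i, k) * f k + f k / real n)"
      using that by (intro sum.cong) (auto simp: distrib_right)
    then show ?thesis
      using sum_laplacian_entries[OF that] by (simp add: sum.distrib sum_divide_distrib)
  qed
  have col: "(\<Sum>k<n. f k) = (\<Sum>i<n. \<Sum>k<n. ?M $$ (i, k) * f k)" for f
    using n sum_laplacian_zero[of f] by (simp add: row sum.distrib verts_lessThan del: index_add_mat)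
  have "det ?M \<noteq> 0"
  proof
    assume "det ?M = 0"
    then obtain v where v: "v \<in> carrier_vec n" "v \<noteq> 0\<^sub>v n" "?M *\<^sub>v v = 0\<^sub>v n"
      unfolding det_0_iff_vec_prod_zero[OF M] by blast
    have Mv: "(\<Sum>k<n. ?M $$ (i, k) * v $ k) = 0" if "i < n" for i
      using mult_mat_vec_entry[OF M v(1) that] v(3) that by simp
    have sum0: "(\<Sum>k<n. v $ k) = 0" using col[of "\<lambda>k. v $ k"] Mv by (simp del: index_add_mat)
    have "laplacian_mat G *\<^sub>v v = 0\<^sub>v n"
    proof (rule eq_vecI)
      fix i assume "i < dim_vec (0\<^sub>v n :: real vec)"
      then have i: "i < n" by simp
      then show "(laplacian_mat G *\<^sub>v v) $ i = 0\<^sub>v n $ i"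
        using row[OF i, of "\<lambda>k. v $ k"] Mv[OF i] sum0 laplacian_mult_vec[OF v(1) i]
        by (simp del: index_add_mat)
    qed (use carrier_matD[OF laplacian_carrier] in simp)
    with laplacian_kernel[OF conn v(1)] obtain c where c: "v = vec n (\<lambda>_. c)" by blast
    with sum0 n have "c = 0" by simp
    with c v(2) show False by (auto simp: zero_vec_def)
  qed
  then obtain X where X: "X \<in> carrier_mat n n" and MX: "?M * X = 1\<^sub>m n"
    using det_non_zero_imp_unit[OF M, of "()"] unfolding Units_def ring_mat_def by auto
  have entry: "(\<Sum>k<n. ?M $$ (i, k) * X $$ (k, j)) = of_bool (i = j)" if "i < n" "j < n" for i j
    unfolding mult_mat_entry[OF M X that, symmetric] MX using that by simp
  have colX: "(\<Sum>k<n. X $$ (k, j)) = 1" if "j < n" for j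
    using col[of "\<lambda>k. X $$ (k, j)"] that by (simp add: entry of_bool_def del: index_add_mat)
  have "laplacian (\<lambda>k. X $$ (k, j)) i = of_bool (i = j) - 1 / real n" if "i < n" "j < n" for i j
    using row[OF that(1), of "\<lambda>k. X $$ (k, j)"] entry[OF that] colX[OF that(2)]
    by (simp del: index_add_mat)
  then have "green_kernel (\<lambda>i j. X $$ (i, j))"
    by (auto simp: green_kernel_def verts)
  with X MX colX show thesis
    by (intro that) (auto simp: verts_lessThan)
qed

end

theorem corollary2:
  fixes G :: "nat pair_pre_digraph" and n :: nat and rho_star :: real
  assumes "n \<ge> 2"
    and "pair_graph G"
    and "pverts G = {0..<n}"
    and "connected (with_proj G)"
    and "rho_ss_centering (laplacian_mat G) = rho_star"
  shows "(real n - 1)\<^sup>2 / (2 * rho_star) \<le> real (num_nonzero_entries (adjacency_mat G)) \<and>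
    real (num_nonzero_entries (adjacency_mat G))
      \<le> (real n - 1) *
         (real n - 4 * ((rho_star - 1 / 2 + 1 / (2 * real n)) / real_of_ereal (graph_diameter G)))"
proof -
  interpret pair_graph G by fact
  interpret numbered_graph G n by unfold_locales fact
  note conn = assms(4)
  have n: "0 < n" "2 \<le> n" using assms(1) by auto
  let ?L = "laplacian_mat G"
  define m where "m = real (card (parcs G))"
  define D where "D = real_of_ereal (graph_diameter G)"
  obtain es where es: "sorted_eigenvalues ?L = 0 # es"
    and cp: "char_poly ?L = (\<Prod>e\<leftarrow>0 # es. [:- e, 1:])"
    and len: "length es = n - 1" and nonneg: "\<And>e. e \<in> set es \<Longrightarrow> 0 \<le> e"
    using laplacian_spectrum[OF n(1)] by blast
  obtain X where X: "X \<in> carrier_mat n n" "(?L + mat n n (\<lambda>_. 1 / real n)) * X = 1\<^sub>m n"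
    and green: "green_kernel (\<lambda>i j. X $$ (i, j))"
    and colX: "\<And>j. j \<in> pverts G \<Longrightarrow> (\<Sum>k\<in>pverts G. X $$ (k, j)) = 1"
    using shifted_laplacian_inverse[OF conn n(1)] by blast
  have tr: "0 \<notin> set es" "mat_trace X = 1 + (\<Sum>e\<leftarrow>es. inverse e)"
    by (rule mat_trace_shifted_inverse[OF laplacian_carrier n(1) cp _ X];
        rule laplacian_kernel[OF conn]; assumption)+
  have pos: "0 < e" if "e \<in> set es" for e
    using nonneg[OF that] tr(1) that by (cases "e = 0") auto
  have rho: "2 * rho_star = (\<Sum>e\<leftarrow>es. inverse e)"
  proof -
    \<comment> \<open>Index \<open>i\<close> means position \<open>i - 1\<close> of \<open>0 # es\<close>, that is position \<open>i - 2\<close> of \<open>es\<close>.\<close>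
    have "(\<Sum>i = 2..n. inverse (sorted_eigenvalues ?L ! (i - 1))) = (\<Sum>i<n - 1. inverse (es ! i))"
      by (rule sum.reindex_bij_witness[where i = "\<lambda>i. i + 2" and j = "\<lambda>i. i - 2"])
         (auto simp: es nth_Cons' numeral_2_eq_2)
    also have "\<dots> = (\<Sum>e\<leftarrow>es. inverse e)"
      using len by (simp add: sum_list_sum_nth atLeast0LessThan)
    finally show ?thesis
      using assms(5) carrier_matD[OF laplacian_carrier] by (simp add: rho_ss_centering_def)
  qed
  have m_eq: "m = sum_list es"
    using mat_trace_eq_sum_eigenvalues[OF laplacian_carrier cp] laplacian_trace by (simp add: m_def)

  have cs: "(real n - 1)\<^sup>2 \<le> m * (2 * rho_star)"
    using square_length_le_sum_times_sum_inverse[of es, OF pos] len n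
    by (simp add: m_eq rho of_nat_diff)
  moreover have "0 < (real n - 1)\<^sup>2" using n by simp
  ultimately have "0 < m * (2 * rho_star)" by linarith
  then have "0 < 2 * rho_star" by (auto simp: zero_less_mult_iff m_def)
  with cs have lower: "(real n - 1)\<^sup>2 / (2 * rho_star) \<le> m"
    by (simp add: pos_divide_le_eq)

  define s where "s = rho_star - 1 / 2 + 1 / (2 * real n)"
  have trX: "(\<Sum>u\<in>pverts G. X $$ (u, u)) - 1 = 2 * rho_star"
    using tr(2) X(1) by (simp add: rho mat_trace_def verts_lessThan)
  have ne: "pverts G \<noteq> {}" using n by (simp add: verts)
  have total: "(\<Sum>u\<in>pverts G. \<Sum>v\<in>pverts G. resistance (\<lambda>i j. X $$ (i, j)) u v)
      = 2 * real n * (2 * rho_star)"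
    by (subst resistance_sum_pairs) (use colX trX in simp_all)
  have "2 * real n * (2 * rho_star) \<le> 2 * (real n - 1) + D * (real n * (real n - 1) - m)"
    using sum_resistance_le[OF conn ne green] by (simp add: total D_def m_def)
  moreover have "4 * real n * s = 2 * real n * (2 * rho_star) - 2 * (real n - 1)"
    using n by (simp add: s_def field_simps)
  ultimately have "4 * real n * s \<le> D * (real n * (real n - 1) - m)" by simp
  moreover have D: "0 < D"
  proof -
    obtain p where p: "apath 0 p 1" "real (length p) \<le> D"
      using apath_length_le_diameter[OF conn, of 0 1] n unfolding D_def by (auto simp: verts)
    then have "p \<noteq> []" by (auto simp: apath_Nil_iff)
    then show ?thesis using p(2) by (cases p) auto
  qed
  ultimately have main: "real n * (4 * (s / D)) \<le> real n * (real n - 1) - m"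
    by (simp add: field_simps)
  have max: "0 \<le> real n * (real n - 1) - m"
    using card_nonadjacent_pairs by (simp add: m_def flip: card_nonadjacent_pairs)
  have "(real n - 1) * (4 * (s / D)) \<le> real n * (real n - 1) - m"
    \<comment> \<open>For negative \<open>s\<close> the left-hand side is negative and the number of nonadjacent pairs is not.\<close>
  proof (cases "0 \<le> s")
    case True
    then have "(real n - 1) * (4 * (s / D)) \<le> real n * (4 * (s / D))"
      using D by (intro mult_right_mono) auto
    with main show ?thesis by simp
  next
    case False
    then have "(real n - 1) * (4 * (s / D)) \<le> 0"
      using D n by (intro mult_nonneg_nonpos) (auto simp: divide_le_0_iff)
    with max show ?thesis by simp
  qed
  then have "m \<le> (real n - 1) * (real n - 4 * (s / D))" by (simp add: algebra_simps)
  with lower show ?thesis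
    by (simp add: adjacency_nonzero_entries m_def s_def D_def)
qed

end
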